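(* Let $f\in S=\mathbb F_q[x,\sigma,\delta]$ be a W-polynomial of degree $n$ with a P-independent set $A=\{a_0,a_1,\ldots,a_{n-1}\}$ (so $f$ is the minimal polynomial of $A$), and suppose $x\in\operatorname{Idl}(Sf)$. Let $T_{C_f}:\mathbb F_q^n\to\mathbb F_q^n$ be the $(\sigma,\delta)$-pseudo-linear transformation $T_{C_f}(v)=\sigma(v)C_f+\delta(v)$. Then: 1. $\mathbb F_q^n=\bigoplus_{i=0}^{n-1}V_{\Gamma_i}$, where $V_{\Gamma_i}$ is the vector space spanned by the eigenvectors of $T_{C_f}$ associated with an eigenvalue in $\Gamma_i:=\Delta(a_i)$. 2. Each $V_{\Gamma_i}$ is a $T_{C_f}$-invariant left $S$-submodule of $\mathbb F_q^n$. 3. There are linear transformations $E_0,\ldots,E_{n-1}$ of $\mathbb F_q^n$ such that $\sum_{i=0}^{n-1}E_i=\operatorname{Id}$, $E_iE_j=0$ for $i\ne j$, and the range of each $E_i$ is $V_{\Gamma_i}$.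
   Context: $\mathbb F_q$ is a finite field, $\sigma\in\operatorname{Aut}(\mathbb F_q)$, and $\delta:\mathbb F_q\to\mathbb F_q$ is additive with $\delta(ab)=\sigma(a)\delta(b)+\delta(a)b$. $S=\mathbb F_q[x,\sigma,\delta]$ is the Ore extension: polynomials with coefficients on the left, usual addition, multiplication determined by $xa=\sigma(a)x+\delta(a)$ and $x^rx^s=x^{r+s}$. $\operatorname{Idl}(Sf)=\{g\in S:fg\in Sf\}$. Evaluation: $N_0(a)=1$, $N_{i+1}(a)=\sigma(N_i(a))a+\delta(N_i(a))$, and for $g=\sum g_ix^i\in S$, $g(a)=\sum g_iN_i(a)$. For $X\subseteq\mathbb F_q$, $I(X)=\{g\in S:g(a)=0\ \forall a\in X\}$; its monic generator as a left ideal is the minimal polynomial of $X$. For $g\in S$, $V(g)=\{a\in\mathbb F_q:g(a)=0\}$. A monic $g$ is a W-polynomial if the minimal polynomial of $V(g)$ is $g$. An element $a$ is P-dependent on $X$ if $g(a)=0$ for every $g\in I(X)$; $X$ is P-independent if no $b\in X$ is P-dependent on $X\setminus\{b\}$. For $a\in\mathbb F_q$, $c\in\mathbb F_q^*$, $a^c=\sigma(c)ac^{-1}+\delta(c)c^{-1}$, and $\Delta(a)=\{a^c:c\in\mathbb F_q^*\}$ is the $(\sigma,\delta)$-conjugacy class of $a$. For $f=-f_0-f_1x-\cdots-f_{n-1}x^{n-1}+x^n$, $C_f$ is the $n\times n$ matrix whose $i$-th row is the $(i+1)$-st standard basis vector for $1\le i\le n-1$ and whose last row is $(f_0,\ldots,f_{n-1})$;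 $\sigma,\delta$ act entrywise on vectors. An eigenvalue of $T_{C_f}$ is an $\alpha\in\mathbb F_q$ with $T_{C_f}(v)=\alpha v$ for some nonzero $v\in\mathbb F_q^n$; such $v$ is an eigenvector associated with $\alpha$. $\mathbb F_q^n$ is a left $S$-module via $g\cdot v=g(T_{C_f})(v)=\sum g_iT_{C_f}^i(v)$ for $g=\sum g_ix^i$.
   Formalization: The direct sum and the maps E_i are indexed by the distinct classes among Γ_0,…,Γ_{n-1}, not by i; with a repeated class the printed claim fails (q=4, σ Frobenius, δ=0, f=x²−1, A={1,w}: both V_{Γ_i} are the whole space). *)

theory Defs
  imports "HOL-Computational_Algebra.Polynomial" "Jordan_Normal_Form.VS_Connect"
begin

section \<open>The Ore extension\<close>

locale ore_data = field_isom \<sigma>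
  for \<sigma> :: "'a::field \<Rightarrow> 'a" +
  fixes \<delta> :: "'a \<Rightarrow> 'a"
  assumes delta_add: "\<delta> (a + b) = \<delta> a + \<delta> b"
    and delta_mult: "\<delta> (a * b) = \<sigma> a * \<delta> b + \<delta> a * b"

text \<open>
  The elements of \<open>S = F[x, \<sigma>, \<delta>]\<close> are represented by the type \<open>'a poly\<close>, whose coefficients are read
  as standing to the left of the powers of \<open>x\<close>. Addition, degree and leading coefficient are those
  of \<open>'a poly\<close>; the commutative product of \<open>'a poly\<close> is never used and is replaced by \<open>ore_mult\<close>.
  Left multiplication by \<open>x\<close> is \<open>x (\<Sum> g\<^sub>i x\<^sup>i) = \<Sum> \<sigma>(g\<^sub>i) x\<^sup>i\<^sup>+\<^sup>1 + \<Sum> \<delta>(g\<^sub>i) x\<^sup>i\<close>.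
\<close>

definition ore_xmult :: "('a::field \<Rightarrow> 'a) \<Rightarrow> ('a \<Rightarrow> 'a) \<Rightarrow> 'a poly \<Rightarrow> 'a poly" where
  "ore_xmult \<sigma> \<delta> g = pCons 0 (map_poly \<sigma> g) + map_poly \<delta> g"

definition ore_mult :: "('a::field \<Rightarrow> 'a) \<Rightarrow> ('a \<Rightarrow> 'a) \<Rightarrow> 'a poly \<Rightarrow> 'a poly \<Rightarrow> 'a poly" where
  "ore_mult \<sigma> \<delta> f g =
     (\<Sum>i\<le>degree f. Polynomial.smult (coeff f i) ((ore_xmult \<sigma> \<delta> ^^ i) g))"

text \<open>The following facts show that \<open>ore_mult\<close> is the multiplication of the Ore extension.\<close>

lemma ore_mult_altdef:
  assumes "degree f \<le> n"
  shows "ore_mult \<sigma> \<delta> f g =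
    (\<Sum>i\<le>n. Polynomial.smult (coeff f i) ((ore_xmult \<sigma> \<delta> ^^ i) g))"
  unfolding ore_mult_def using assms
  by (intro sum.mono_neutral_left) (auto simp: coeff_eq_0)

lemma ore_mult_add_left:
  "ore_mult \<sigma> \<delta> (f + g) h = ore_mult \<sigma> \<delta> f h + ore_mult \<sigma> \<delta> g h"
proof -
  define n where "n = max (degree f) (degree g)"
  have "degree (f + g) \<le> n" "degree f \<le> n" "degree g \<le> n"
    by (auto simp: n_def degree_add_le_max)
  then show ?thesis
    by (simp add: ore_mult_altdef[of _ n] smult_add_left sum.distrib)
qed

lemma ore_mult_smult_left:
  "ore_mult \<sigma> \<delta> (Polynomial.smult c f) h = Polynomial.smult c (ore_mult \<sigma> \<delta> f h)"
  by (subst ore_mult_altdef[of _ "degree f"])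
     (auto simp: degree_smult_le ore_mult_def poly_eq_iff coeff_sum sum_distrib_left mult.assoc)

lemma ore_mult_0_left: "ore_mult \<sigma> \<delta> 0 h = 0"
  by (simp add: ore_mult_def)

lemma ore_mult_sum_left:
  "ore_mult \<sigma> \<delta> (\<Sum>i\<in>I. f i) h = (\<Sum>i\<in>I. ore_mult \<sigma> \<delta> (f i) h)"
  by (induction I rule: infinite_finite_induct) (auto simp: ore_mult_0_left ore_mult_add_left)

lemma ore_mult_const_left: "ore_mult \<sigma> \<delta> [:c:] h = Polynomial.smult c h"
  by (simp add: ore_mult_def)

context ore_data
begin

lemma delta_0 [simp]: "\<delta> 0 = 0"
  using delta_add[of 0 0] by (metis add_0_right add_left_cancel)

lemma delta_1 [simp]: "\<delta> 1 = 0"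
  using delta_mult[of 1 1] by (metis add_0_right add_left_cancel hom_one mult_1 mult_1_right)

lemma coeff_ore_xmult:
  "coeff (ore_xmult \<sigma> \<delta> g) i = (if i = 0 then 0 else \<sigma> (coeff g (i - 1))) + \<delta> (coeff g i)"
  by (cases i) (auto simp: ore_xmult_def coeff_map_poly)

lemma ore_xmult_add: "ore_xmult \<sigma> \<delta> (g + h) = ore_xmult \<sigma> \<delta> g + ore_xmult \<sigma> \<delta> h"
  by (rule poly_eqI) (auto simp: coeff_ore_xmult hom_add delta_add)

lemma ore_xmult_0 [simp]: "ore_xmult \<sigma> \<delta> 0 = 0"
  by (simp add: ore_xmult_def)

lemma ore_xmult_sum: "ore_xmult \<sigma> \<delta> (\<Sum>i\<in>I. f i) = (\<Sum>i\<in>I. ore_xmult \<sigma> \<delta> (f i))"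
  by (induction I rule: infinite_finite_induct) (auto simp: ore_xmult_add)

lemma ore_xmult_smult:
  "ore_xmult \<sigma> \<delta> (Polynomial.smult c g) =
     Polynomial.smult (\<sigma> c) (ore_xmult \<sigma> \<delta> g) + Polynomial.smult (\<delta> c) g"
  by (rule poly_eqI) (auto simp: coeff_ore_xmult hom_mult delta_mult algebra_simps)

lemma ore_xmult_monom: "ore_xmult \<sigma> \<delta> (monom 1 s) = monom 1 (Suc s)"
  by (rule poly_eqI) (auto simp: coeff_ore_xmult)

lemma funpow_ore_xmult_add:
  "(ore_xmult \<sigma> \<delta> ^^ i) (g + h) = (ore_xmult \<sigma> \<delta> ^^ i) g + (ore_xmult \<sigma> \<delta> ^^ i) h"
  by (induction i) (auto simp: ore_xmult_add)

lemma ore_mult_add_right: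
  "ore_mult \<sigma> \<delta> f (g + h) = ore_mult \<sigma> \<delta> f g + ore_mult \<sigma> \<delta> f h"
  by (simp add: ore_mult_def funpow_ore_xmult_add smult_add_right sum.distrib)

lemma ore_mult_monom_left: "ore_mult \<sigma> \<delta> (monom 1 r) g = (ore_xmult \<sigma> \<delta> ^^ r) g"
  by (simp add: ore_mult_def degree_monom_eq if_distrib[of "\<lambda>c. Polynomial.smult c _"]
      cong: if_cong)

lemma ore_mult_x_const: "ore_mult \<sigma> \<delta> [:0, 1:] [:a:] = [:\<delta> a, \<sigma> a:]"
  by (rule poly_eqI)
     (auto simp: ore_mult_def coeff_ore_xmult coeff_pCons split: nat.split)

lemma ore_mult_monom_monom:
  "ore_mult \<sigma> \<delta> (monom 1 r) (monom 1 s) = monom 1 (r + s)"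
proof -
  have "(ore_xmult \<sigma> \<delta> ^^ r) (monom 1 s) = monom 1 (r + s)"
    by (induction r) (auto simp: ore_xmult_monom)
  then show ?thesis by (simp add: ore_mult_monom_left)
qed

lemma ore_mult_xmult_left:
  "ore_mult \<sigma> \<delta> (ore_xmult \<sigma> \<delta> g) h = ore_xmult \<sigma> \<delta> (ore_mult \<sigma> \<delta> g h)"
proof -
  define n where "n = degree g"
  let ?X = "ore_xmult \<sigma> \<delta>"
  have z: "coeff g (Suc n) = 0"
    by (simp add: n_def coeff_eq_0)
  have deg: "degree (?X g) \<le> Suc n"
    by (rule degree_le) (auto simp: coeff_ore_xmult n_def coeff_eq_0)
  have "ore_mult \<sigma> \<delta> (?X g) h =
      (\<Sum>i\<le>Suc n. Polynomial.smult (if i = 0 then 0 else \<sigma> (coeff g (i - 1))) ((?X ^^ i) h)) +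
      (\<Sum>i\<le>Suc n. Polynomial.smult (\<delta> (coeff g i)) ((?X ^^ i) h))"
    by (subst ore_mult_altdef[OF deg])
       (simp only: coeff_ore_xmult smult_add_left sum.distrib)
  also have "(\<Sum>i\<le>Suc n. Polynomial.smult (if i = 0 then 0 else \<sigma> (coeff g (i - 1))) ((?X ^^ i) h)) =
      (\<Sum>i\<le>n. Polynomial.smult (\<sigma> (coeff g i)) (?X ((?X ^^ i) h)))"
    by (subst sum.atMost_Suc_shift) simp
  also have "(\<Sum>i\<le>Suc n. Polynomial.smult (\<delta> (coeff g i)) ((?X ^^ i) h)) =
      (\<Sum>i\<le>n. Polynomial.smult (\<delta> (coeff g i)) ((?X ^^ i) h))"
    using z by simp
  finally show ?thesis
    by (simp add: ore_mult_def ore_xmult_sum ore_xmult_smult sum.distrib n_def)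
qed

lemma ore_mult_assoc:
  "ore_mult \<sigma> \<delta> (ore_mult \<sigma> \<delta> f g) h = ore_mult \<sigma> \<delta> f (ore_mult \<sigma> \<delta> g h)"
proof -
  have "ore_mult \<sigma> \<delta> ((ore_xmult \<sigma> \<delta> ^^ i) g) h = (ore_xmult \<sigma> \<delta> ^^ i) (ore_mult \<sigma> \<delta> g h)" for i
    by (induction i) (auto simp: ore_mult_xmult_left)
  then show ?thesis
    by (simp add: ore_mult_def[of \<sigma> \<delta> f] ore_mult_sum_left ore_mult_smult_left)
qed

end

definition left_ideal_gen :: "('a::field \<Rightarrow> 'a) \<Rightarrow> ('a \<Rightarrow> 'a) \<Rightarrow> 'a poly \<Rightarrow> 'a poly set" where
  "left_ideal_gen \<sigma> \<delta> f = {ore_mult \<sigma> \<delta> h f | h. True}"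

definition idealizer :: "('a::field \<Rightarrow> 'a) \<Rightarrow> ('a \<Rightarrow> 'a) \<Rightarrow> 'a poly \<Rightarrow> 'a poly set" where
  "idealizer \<sigma> \<delta> f = {g. ore_mult \<sigma> \<delta> f g \<in> left_ideal_gen \<sigma> \<delta> f}"


section \<open>Evaluation, minimal polynomials, P-independence\<close>

primrec ore_N :: "('a::field \<Rightarrow> 'a) \<Rightarrow> ('a \<Rightarrow> 'a) \<Rightarrow> 'a \<Rightarrow> nat \<Rightarrow> 'a" where
  "ore_N \<sigma> \<delta> a 0 = 1"
| "ore_N \<sigma> \<delta> a (Suc i) = \<sigma> (ore_N \<sigma> \<delta> a i) * a + \<delta> (ore_N \<sigma> \<delta> a i)"

definition ore_eval :: "('a::field \<Rightarrow> 'a) \<Rightarrow> ('a \<Rightarrow> 'a) \<Rightarrow> 'a poly \<Rightarrow> 'a \<Rightarrow> 'a" where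
  "ore_eval \<sigma> \<delta> g a = (\<Sum>i\<le>degree g. coeff g i * ore_N \<sigma> \<delta> a i)"

definition vanishing_ideal :: "('a::field \<Rightarrow> 'a) \<Rightarrow> ('a \<Rightarrow> 'a) \<Rightarrow> 'a set \<Rightarrow> 'a poly set" where
  "vanishing_ideal \<sigma> \<delta> X = {g. \<forall>a\<in>X. ore_eval \<sigma> \<delta> g a = 0}"

definition zero_set :: "('a::field \<Rightarrow> 'a) \<Rightarrow> ('a \<Rightarrow> 'a) \<Rightarrow> 'a poly \<Rightarrow> 'a set" where
  "zero_set \<sigma> \<delta> g = {a. ore_eval \<sigma> \<delta> g a = 0}"

definition is_min_poly :: "('a::field \<Rightarrow> 'a) \<Rightarrow> ('a \<Rightarrow> 'a) \<Rightarrow> 'a set \<Rightarrow> 'a poly \<Rightarrow> bool" where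
  "is_min_poly \<sigma> \<delta> X g \<longleftrightarrow>
     lead_coeff g = 1 \<and> vanishing_ideal \<sigma> \<delta> X = left_ideal_gen \<sigma> \<delta> g"

definition W_polynomial :: "('a::field \<Rightarrow> 'a) \<Rightarrow> ('a \<Rightarrow> 'a) \<Rightarrow> 'a poly \<Rightarrow> bool" where
  "W_polynomial \<sigma> \<delta> g \<longleftrightarrow> lead_coeff g = 1 \<and> is_min_poly \<sigma> \<delta> (zero_set \<sigma> \<delta> g) g"

definition P_dependent :: "('a::field \<Rightarrow> 'a) \<Rightarrow> ('a \<Rightarrow> 'a) \<Rightarrow> 'a \<Rightarrow> 'a set \<Rightarrow> bool" where
  "P_dependent \<sigma> \<delta> a X \<longleftrightarrow> (\<forall>g\<in>vanishing_ideal \<sigma> \<delta> X. ore_eval \<sigma> \<delta> g a = 0)"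

definition P_independent :: "('a::field \<Rightarrow> 'a) \<Rightarrow> ('a \<Rightarrow> 'a) \<Rightarrow> 'a set \<Rightarrow> bool" where
  "P_independent \<sigma> \<delta> X \<longleftrightarrow> (\<forall>b\<in>X. \<not> P_dependent \<sigma> \<delta> b (X - {b}))"

definition conj_class :: "('a::field \<Rightarrow> 'a) \<Rightarrow> ('a \<Rightarrow> 'a) \<Rightarrow> 'a \<Rightarrow> 'a set" where
  "conj_class \<sigma> \<delta> a = {\<sigma> c * a * inverse c + \<delta> c * inverse c | c. c \<noteq> 0}"


section \<open>The pseudo-linear transformation and its module\<close>

text \<open>
  Row and column indices start at 0. As \<open>f = - f\<^sub>0 - \<dots> + x\<^sup>n\<close>, the entry \<open>f\<^sub>j\<close> of the last row is the
  negative of the \<open>j\<close>-th coefficient of \<open>f\<close>.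
\<close>

definition companion :: "nat \<Rightarrow> 'a::field poly \<Rightarrow> 'a mat" where
  "companion n f = mat n n (\<lambda>(i, j).
     if i = n - 1 then - coeff f j else if j = i + 1 then 1 else 0)"

text \<open>The row vector \<open>v C\<close> is \<open>C\<^sup>T v\<close>, the field being commutative.\<close>

definition pseudo_lin ::
  "('a::field \<Rightarrow> 'a) \<Rightarrow> ('a \<Rightarrow> 'a) \<Rightarrow> 'a mat \<Rightarrow> 'a vec \<Rightarrow> 'a vec" where
  "pseudo_lin \<sigma> \<delta> C v = transpose_mat C *\<^sub>v map_vec \<sigma> v + map_vec \<delta> v"

definition ore_action :: "nat \<Rightarrow> ('a::field vec \<Rightarrow> 'a vec) \<Rightarrow> 'a poly \<Rightarrow> 'a vec \<Rightarrow> 'a vec" where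
  "ore_action n T g v = finsum_vec TYPE('a) n (\<lambda>i. coeff g i \<cdot>\<^sub>v (T ^^ i) v) {..degree g}"

definition left_submodule :: "nat \<Rightarrow> ('a::field vec \<Rightarrow> 'a vec) \<Rightarrow> 'a vec set \<Rightarrow> bool" where
  "left_submodule n T W \<longleftrightarrow> W \<subseteq> carrier_vec n \<and> 0\<^sub>v n \<in> W \<and>
     (\<forall>v\<in>W. \<forall>w\<in>W. v + w \<in> W) \<and> (\<forall>g. \<forall>v\<in>W. ore_action n T g v \<in> W)"

definition is_eigenvector :: "nat \<Rightarrow> ('a::field vec \<Rightarrow> 'a vec) \<Rightarrow> 'a \<Rightarrow> 'a vec \<Rightarrow> bool" where
  "is_eigenvector n T \<alpha> v \<longleftrightarrow> v \<in> carrier_vec n \<and> v \<noteq> 0\<^sub>v n \<and> T v = \<alpha> \<cdot>\<^sub>v v"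

definition eigen_span :: "nat \<Rightarrow> ('a::field vec \<Rightarrow> 'a vec) \<Rightarrow> 'a set \<Rightarrow> 'a vec set" where
  "eigen_span n T \<Gamma> = LinearCombinations.module.span class_ring (module_vec TYPE('a) n)
     {v. \<exists>\<alpha>\<in>\<Gamma>. is_eigenvector n T \<alpha> v}"

definition internal_direct_sum :: "nat \<Rightarrow> 'i set \<Rightarrow> ('i \<Rightarrow> 'a::field vec set) \<Rightarrow> bool" where
  "internal_direct_sum n I W \<longleftrightarrow>
     (\<forall>i\<in>I. VectorSpace.subspace class_ring (W i) (module_vec TYPE('a) n)) \<and>
     (\<forall>v\<in>carrier_vec n. \<exists>!w. w \<in> Pi\<^sub>E I W \<and> finsum_vec TYPE('a) n w I = v)"

end

theory Submission
  imports Defs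
begin

text \<open>
  Evaluation at the \<open>n\<close> points \<open>a\<^sub>i\<close> identifies \<open>F\<^sup>n\<close> (polynomials of degree below \<open>n\<close>) with \<open>F\<^sup>n\<close>: a
  polynomial in the kernel is a left multiple of \<open>f\<close>, hence zero. Under this identification
  multiplication by \<open>x\<close> modulo \<open>f\<close>, which is \<open>T\<close>, becomes the diagonal pseudo-linear map
  \<open>c \<mapsto> \<sigma>(c) a\<^sub>i + \<delta>(c)\<close> on the \<open>i\<close>-th coordinate. If \<open>v\<close> is an eigenvector with eigenvalue \<open>\<alpha>\<close> and its
  \<open>i\<close>-th coordinate \<open>c\<close> is nonzero, then \<open>\<alpha>\<close> is the conjugate of \<open>a\<^sub>i\<close> by \<open>c\<close>. So the eigenvectors of a
  class span exactly the coordinate subspace of the indices \<open>i\<close> with \<open>a\<^sub>i\<close> in that class.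
\<close>

section \<open>Degrees of left multiples of a monic polynomial\<close>

context ore_data
begin

lemma delta_sum: "\<delta> (\<Sum>i\<in>I. g i) = (\<Sum>i\<in>I. \<delta> (g i))"
  by (induction I rule: infinite_finite_induct) (auto simp: delta_add)

lemma ore_mult_1_left: "ore_mult \<sigma> \<delta> 1 f = f"
  using ore_mult_const_left[of \<sigma> \<delta> 1 f] by (simp add: one_pCons)

lemma degree_funpow_ore_xmult_le: "degree ((ore_xmult \<sigma> \<delta> ^^ i) f) \<le> degree f + i"
proof (induction i)
  case (Suc i)
  show ?case
    by (rule degree_le) (use Suc in \<open>auto simp: coeff_ore_xmult coeff_eq_0\<close>)
qed simp

text \<open>At the new top index the shift contributes \<sigma>(1) = 1, and the \<delta> part
  contributes \<delta>(0) = 0, because that index lies beyond the previous degree.\<close>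

lemma coeff_funpow_ore_xmult_monic:
  assumes "lead_coeff f = 1"
  shows "coeff ((ore_xmult \<sigma> \<delta> ^^ i) f) (degree f + i) = 1"
proof (induction i)
  case (Suc i)
  have "degree ((ore_xmult \<sigma> \<delta> ^^ i) f) < degree f + Suc i"
    using degree_funpow_ore_xmult_le[of i f] by simp
  then show ?case
    using Suc by (simp add: coeff_ore_xmult coeff_eq_0)
qed (use assms in simp)

text \<open>Nothing cancels the top term: x^i f is monic of degree \<open>degree f + i\<close>, so
  only the leading term of \<open>h\<close> reaches index \<open>degree f + degree h\<close>, where
  it leaves the nonzero \<open>lead_coeff h\<close>.\<close>

lemma degree_ore_mult_monic_ge:
  assumes "lead_coeff f = 1" "ore_mult \<sigma> \<delta> h f \<noteq> 0"
  shows "degree f \<le> degree (ore_mult \<sigma> \<delta> h f)"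
proof -
  define m where "m = degree h"
  have "h \<noteq> 0"
    using assms(2) by (auto simp: ore_mult_0_left)
  have "coeff (ore_mult \<sigma> \<delta> h f) (degree f + m) =
      (\<Sum>i\<le>m. coeff h i * coeff ((ore_xmult \<sigma> \<delta> ^^ i) f) (degree f + m))"
    by (simp add: ore_mult_def coeff_sum m_def)
  also have "\<dots> = (\<Sum>i\<le>m. if i = m then coeff h m else 0)"
  proof (rule sum.cong)
    fix i assume "i \<in> {..m}"
    then show "coeff h i * coeff ((ore_xmult \<sigma> \<delta> ^^ i) f) (degree f + m) =
        (if i = m then coeff h m else 0)"
      using coeff_funpow_ore_xmult_monic[OF assms(1), of m] degree_funpow_ore_xmult_le[of i f]
      by (auto simp: coeff_eq_0)
  qed simp
  also have "\<dots> = lead_coeff h"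
    by (simp add: m_def)
  finally have "coeff (ore_mult \<sigma> \<delta> h f) (degree f + m) \<noteq> 0"
    using \<open>h \<noteq> 0\<close> by simp
  then show ?thesis
    by (meson le_add1 le_degree le_trans)
qed

section \<open>Conjugacy as an equivalence relation\<close>

lemma conj_class_refl: "a \<in> conj_class \<sigma> \<delta> a"
  unfolding conj_class_def by (auto intro!: exI[of _ 1])

text \<open>Conjugating by c and then by d is conjugating by dc, because \<delta>(dc) =
  \<sigma>(d)\<delta>(c) + \<delta>(d)c.\<close>

lemma conj_class_subset:
  assumes "b \<in> conj_class \<sigma> \<delta> a"
  shows "conj_class \<sigma> \<delta> b \<subseteq> conj_class \<sigma> \<delta> a"
proof
  fix z assume "z \<in> conj_class \<sigma> \<delta> b"
  then obtain d where d: "d \<noteq> 0" "z = \<sigma> d * b * inverse d + \<delta> d * inverse d"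
    unfolding conj_class_def by auto
  obtain c where c: "c \<noteq> 0" "b = \<sigma> c * a * inverse c + \<delta> c * inverse c"
    using assms unfolding conj_class_def by auto
  have "z = \<sigma> (d * c) * a * inverse (d * c) + \<delta> (d * c) * inverse (d * c)"
    using c(1) d(1) unfolding c(2) d(2) hom_mult delta_mult by (simp add: field_simps)
  then show "z \<in> conj_class \<sigma> \<delta> a"
    using c(1) d(1) unfolding conj_class_def by (auto intro!: exI[of _ "d * c"])
qed

text \<open>Conjugation by the inverse of c undoes conjugation by c. The terms free of
  \<open>a\<close> cancel, since they add up to \<delta> applied to the product of c and its
  inverse, which is \<delta>(1) = 0.\<close>

lemma conj_class_sym:
  assumes "b \<in> conj_class \<sigma> \<delta> a"
  shows "a \<in> conj_class \<sigma> \<delta> b"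
proof -
  obtain c where c: "c \<noteq> 0" "b = \<sigma> c * a * inverse c + \<delta> c * inverse c"
    using assms unfolding conj_class_def by auto
  have nz: "\<sigma> (inverse c) \<noteq> 0" "\<sigma> c \<noteq> 0"
    using c(1) by auto
  have "\<sigma> c * \<sigma> (inverse c) = 1"
    using c(1) by (metis hom_mult hom_one right_inverse)
  moreover have "\<sigma> (inverse c) * \<delta> c + \<delta> (inverse c) * c = 0"
    using delta_mult[of "inverse c" c] c(1) by simp
  moreover have "\<sigma> (inverse c) * b * c + \<delta> (inverse c) * c =
      (\<sigma> c * \<sigma> (inverse c)) * a + (\<sigma> (inverse c) * \<delta> c + \<delta> (inverse c) * c)"
    using c(1) unfolding c(2) by (simp add: field_simps)
  ultimately have "a = \<sigma> (inverse c) * b * inverse (inverse c) + \<delta> (inverse c) * inverse (inverse c)"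
    by simp
  then show ?thesis
    using c(1) unfolding conj_class_def by (auto intro!: exI[of _ "inverse c"])
qed

lemma conj_class_eq: "b \<in> conj_class \<sigma> \<delta> a \<Longrightarrow> conj_class \<sigma> \<delta> b = conj_class \<sigma> \<delta> a"
  by (simp add: conj_class_subset conj_class_sym subset_antisym)

end

section \<open>Evaluation at the points as coordinates on F^n\<close>

locale ore_min_poly = ore_data \<sigma> \<delta>
  for \<sigma> \<delta> :: "'a::field \<Rightarrow> 'a" +
  fixes f :: "'a poly" and n :: nat and a :: "nat \<Rightarrow> 'a"
  assumes degree_f: "degree f = n"
    and min_poly: "is_min_poly \<sigma> \<delta> (a ` {..<n}) f"
begin

sublocale vec_space "TYPE('a)" n .

abbreviation T :: "'a vec \<Rightarrow> 'a vec" where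
  "T \<equiv> pseudo_lin \<sigma> \<delta> (companion n f)"

abbreviation \<Gamma> :: "nat \<Rightarrow> 'a set" where
  "\<Gamma> i \<equiv> conj_class \<sigma> \<delta> (a i)"

text \<open>This is \<open>ore_eval\<close> at \<open>a i\<close> of the polynomial with coefficient
  vector \<open>v\<close>. The summation range is fixed, instead of ending at the degree, so that
  linearity in \<open>v\<close> is immediate.\<close>

definition ev :: "nat \<Rightarrow> 'a vec \<Rightarrow> 'a" where
  "ev i v = (\<Sum>j<n. v $ j * ore_N \<sigma> \<delta> (a i) j)"

lemma monic_f: "lead_coeff f = 1"
  and ideal_f: "vanishing_ideal \<sigma> \<delta> (a ` {..<n}) = left_ideal_gen \<sigma> \<delta> f"
  using min_poly by (auto simp: is_min_poly_def)

text \<open>The monic \<open>f\<close> is a left multiple of itself, so it vanishes at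
  \<open>a i\<close>; the equation is solved for its top term.\<close>

lemma ore_N_reduce:
  assumes "i < n"
  shows "ore_N \<sigma> \<delta> (a i) n = - (\<Sum>j<n. coeff f j * ore_N \<sigma> \<delta> (a i) j)"
proof -
  have "f \<in> left_ideal_gen \<sigma> \<delta> f"
    unfolding left_ideal_gen_def by (auto intro!: exI[of _ 1] simp: ore_mult_1_left)
  then have "ore_eval \<sigma> \<delta> f (a i) = 0"
    using assms unfolding ideal_f[symmetric] vanishing_ideal_def by auto
  then have "(\<Sum>j<n. coeff f j * ore_N \<sigma> \<delta> (a i) j) + ore_N \<sigma> \<delta> (a i) n = 0"
    using monic_f degree_f
    by (simp add: ore_eval_def lessThan_Suc_atMost[symmetric])
  then show ?thesis
    by (simp add: eq_neg_iff_add_eq_0 add.commute)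
qed

lemma ev_add: "v \<in> carrier_vec n \<Longrightarrow> w \<in> carrier_vec n \<Longrightarrow> ev i (v + w) = ev i v + ev i w"
  unfolding ev_def sum.distrib[symmetric] by (rule sum.cong) (auto simp: algebra_simps)

lemma ev_smult: "v \<in> carrier_vec n \<Longrightarrow> ev i (c \<cdot>\<^sub>v v) = c * ev i v"
  by (auto simp: ev_def sum_distrib_left intro!: sum.cong)

lemma ev_0 [simp]: "ev i (0\<^sub>v n) = 0"
  by (simp add: ev_def)

lemma ev_finsum:
  assumes "finite I" "w \<in> I \<rightarrow> carrier_vec n"
  shows "ev i (finsum_vec TYPE('a) n w I) = (\<Sum>G\<in>I. ev i (w G))"
proof -
  have "ev i (finsum_vec TYPE('a) n w I) = (\<Sum>j<n. (\<Sum>G\<in>I. w G $ j) * ore_N \<sigma> \<delta> (a i) j)"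
    unfolding ev_def by (intro sum.cong) (simp_all only: index_finsum_vec[OF assms(1) _ assms(2)] lessThan_iff)
  also have "\<dots> = (\<Sum>G\<in>I. ev i (w G))"
    unfolding ev_def sum_distrib_right by (rule sum.swap)
  finally show ?thesis .
qed

lemma ev_eq_0_imp:
  assumes v: "v \<in> carrier_vec n" and zero: "\<And>i. i < n \<Longrightarrow> ev i v = 0"
  shows "v = 0\<^sub>v n"
proof (rule ccontr)
  assume nz: "v \<noteq> 0\<^sub>v n"
  define g where "g = (\<Sum>j<n. monom (v $ j) j)"
  have coeff_g: "coeff g j = (if j < n then v $ j else 0)" for j
    by (simp add: g_def coeff_sum)
  obtain k where k: "k < n" "v $ k \<noteq> 0"
    using nz v by (metis carrier_vecD eq_vecI index_zero_vec)
  have "g \<noteq> 0"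
    using coeff_g[of k] k by auto
  then have deg: "degree g < n"
    using coeff_g[of "degree g"] leading_coeff_0_iff[of g] by (auto split: if_splits)
  have "ore_eval \<sigma> \<delta> g (a i) = ev i v" for i
  proof -
    have "ore_eval \<sigma> \<delta> g (a i) = (\<Sum>j<n. coeff g j * ore_N \<sigma> \<delta> (a i) j)"
      unfolding ore_eval_def
      by (rule sum.mono_neutral_left) (use deg in \<open>auto simp: coeff_eq_0\<close>)
    then show ?thesis by (simp add: ev_def coeff_g)
  qed
  then have "g \<in> vanishing_ideal \<sigma> \<delta> (a ` {..<n})"
    using zero by (auto simp: vanishing_ideal_def)
  then obtain h where "g = ore_mult \<sigma> \<delta> h f"
    unfolding ideal_f left_ideal_gen_def by auto
  then show False
    using degree_ore_mult_monic_ge[OF monic_f] \<open>g \<noteq> 0\<close> deg degree_f by fastforce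
qed

text \<open>Later identities between vectors are proved through this, by comparing evaluation
  coordinates.\<close>

lemma ev_inject:
  assumes v: "v \<in> carrier_vec n" and w: "w \<in> carrier_vec n"
    and eq: "\<And>i. i < n \<Longrightarrow> ev i v = ev i w"
  shows "v = w"
proof -
  have "v + (- 1) \<cdot>\<^sub>v w = 0\<^sub>v n"
    using v w eq by (intro ev_eq_0_imp) (auto simp: ev_add ev_smult)
  then have "(v + (- 1) \<cdot>\<^sub>v w) $ j = 0" if "j < n" for j
    using that by simp
  then show ?thesis
    using v w by (intro eq_vecI) auto
qed

text \<open>Evaluation is multiplication by the square matrix \<open>M\<close>, the
  (\<sigma>,\<delta>)-Vandermonde matrix of the points. Its kernel is trivial by
  \<open>ev_eq_0_imp\<close>, so it is invertible.\<close>

lemma ev_surj: "\<exists>v\<in>carrier_vec n. \<forall>i<n. ev i v = c i"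
proof -
  define M where "M = mat n n (\<lambda>(i, j). ore_N \<sigma> \<delta> (a i) j)"
  have M: "M \<in> carrier_mat n n"
    by (simp add: M_def)
  have M_ev: "(M *\<^sub>v v) $ i = ev i v" if "v \<in> carrier_vec n" "i < n" for v i
    using that by (auto simp: M_def ev_def scalar_prod_def lessThan_atLeast0 mult.commute intro!: sum.cong)
  have "v = 0\<^sub>v n" if "v \<in> carrier_vec n" "M *\<^sub>v v = 0\<^sub>v n" for v
    using that by (intro ev_eq_0_imp) (simp_all flip: M_ev)
  then have "det M \<noteq> 0"
    using det_0_iff_vec_prod_zero_field[OF M] by auto
  from det_non_zero_imp_unit[OF M this, of "()"] obtain P
    where P: "P \<in> carrier_mat n n" "M * P = 1\<^sub>m n"
    by (auto simp: Units_def ring_mat_def)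
  define v where "v = P *\<^sub>v vec n c"
  have v: "v \<in> carrier_vec n"
    using P by (simp add: v_def)
  have "M *\<^sub>v v = vec n c"
    using assoc_mult_mat_vec[OF M P(1), of "vec n c"] P(2) by (simp add: v_def)
  then have "ev i v = c i" if "i < n" for i
    using M_ev[OF v that] that by simp
  with v show ?thesis by blast
qed

text \<open>The inverse of the coordinate map. The choice exists by \<open>ev_surj\<close> and is
  unique by \<open>ev_inject\<close>; only the values of \<open>c\<close> below \<open>n\<close>
  matter.\<close>

definition interp :: "(nat \<Rightarrow> 'a) \<Rightarrow> 'a vec" where
  "interp c = (SOME v. v \<in> carrier_vec n \<and> (\<forall>i<n. ev i v = c i))"

lemma interp: "interp c \<in> carrier_vec n \<and> (\<forall>i<n. ev i (interp c) = c i)"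
  unfolding interp_def by (rule someI_ex) (use ev_surj[of c] in blast)

lemma interp_carrier [simp]: "interp c \<in> carrier_vec n"
  using interp by blast

lemma ev_interp [simp]: "i < n \<Longrightarrow> ev i (interp c) = c i"
  using interp by blast

section \<open>The pseudo-linear map in evaluation coordinates\<close>

lemma T_carrier [simp]: "T v \<in> carrier_vec n" if "v \<in> carrier_vec n"
proof -
  have "companion n f \<in> carrier_mat n n"
    by (simp add: companion_def)
  then show ?thesis
    using that unfolding pseudo_lin_def by (intro add_carrier_vec mult_mat_vec_carrier[of _ n n]) auto
qed

lemma T_index:
  assumes v: "v \<in> carrier_vec n" and j: "j < n"
  shows "T v $ j = (if j = 0 then 0 else \<sigma> (v $ (j - 1))) - coeff f j * \<sigma> (v $ (n - 1)) + \<delta> (v $ j)"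
proof -
  have "T v $ j = (\<Sum>k<n. companion n f $$ (k, j) * \<sigma> (v $ k)) + \<delta> (v $ j)"
    using v j by (simp add: pseudo_lin_def companion_def scalar_prod_def lessThan_atLeast0)
  \<comment> \<open>Column \<open>j\<close> has an entry in the last row and, if
    \<open>j > 0\<close>, a 1 in row \<open>j - 1\<close>. For \<open>j = 0\<close> the index
    \<open>j - 1\<close> is again 0, so the second term must be set to 0 explicitly.\<close>
  also have "(\<Sum>k<n. companion n f $$ (k, j) * \<sigma> (v $ k)) =
      (\<Sum>k<n. (if k = n - 1 then - coeff f j * \<sigma> (v $ (n - 1)) else 0)
        + (if k = j - 1 then (if j = 0 then 0 else \<sigma> (v $ (j - 1))) else 0))"
    using j by (intro sum.cong) (auto simp: companion_def)
  also have "\<dots> = - coeff f j * \<sigma> (v $ (n - 1)) + (if j = 0 then 0 else \<sigma> (v $ (j - 1)))"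
    using j by (simp add: sum.distrib)
  finally show ?thesis by simp
qed

lemma ev_T:
  assumes v: "v \<in> carrier_vec n" and i: "i < n"
  shows "ev i (T v) = \<sigma> (ev i v) * a i + \<delta> (ev i v)"
proof -
  let ?N = "ore_N \<sigma> \<delta> (a i)"
  obtain m where m: "n = Suc m"
    using i by (cases n) auto
  have "ev i (T v) = (\<Sum>j<n. (if j = 0 then 0 else \<sigma> (v $ (j - 1))) * ?N j)
      - \<sigma> (v $ (n - 1)) * (\<Sum>j<n. coeff f j * ?N j) + (\<Sum>j<n. \<delta> (v $ j) * ?N j)"
    unfolding ev_def sum_distrib_left sum.distrib[symmetric] sum_subtractf[symmetric]
    by (intro sum.cong) (auto simp: T_index[OF v] algebra_simps)
  also have "(\<Sum>j<n. (if j = 0 then 0 else \<sigma> (v $ (j - 1))) * ?N j) = (\<Sum>j<m. \<sigma> (v $ j) * ?N (Suc j))"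
    unfolding m by (subst sum.lessThan_Suc_shift) simp
  \<comment> \<open>Reduction modulo \<open>f\<close> turns the last-row contribution into the term
    with \<open>?N n\<close>, the one that the shifted sum over \<open>j < m\<close> lacks.\<close>
  also have "(\<Sum>j<n. coeff f j * ?N j) = - ?N n"
    using ore_N_reduce[OF i] by simp
  also have "(\<Sum>j<m. \<sigma> (v $ j) * ?N (Suc j)) - \<sigma> (v $ (n - 1)) * - ?N n = (\<Sum>j<n. \<sigma> (v $ j) * ?N (Suc j))"
    by (simp add: m del: ore_N.simps)
  \<comment> \<open>Termwise, unfold the recursion of \<open>ore_N\<close> and collect the two
    \<delta> terms by the product rule for \<open>v $ j * ?N j\<close>.\<close>
  also have "\<dots> + (\<Sum>j<n. \<delta> (v $ j) * ?N j) =
      (\<Sum>j<n. \<sigma> (v $ j * ?N j) * a i + \<delta> (v $ j * ?N j))"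
    unfolding sum.distrib[symmetric]
    by (intro sum.cong) (auto simp: hom_mult delta_mult algebra_simps)
  also have "\<dots> = \<sigma> (ev i v) * a i + \<delta> (ev i v)"
    by (simp add: ev_def hom_sum delta_sum sum.distrib sum_distrib_right)
  finally show ?thesis .
qed

section \<open>Coordinate subspaces of the classes and spans of eigenvectors\<close>

definition coord_space :: "'a set \<Rightarrow> 'a vec set" where
  "coord_space G = {v \<in> carrier_vec n. \<forall>i<n. \<Gamma> i \<noteq> G \<longrightarrow> ev i v = 0}"

lemma submodule_coord_space: "submodule class_ring (coord_space G) V"
  by unfold_locales (auto simp: coord_space_def ev_add ev_smult module_vec_simps)

lemma eigenvector_in_coord_space:
  assumes v: "is_eigenvector n T \<alpha> v" and \<alpha>: "\<alpha> \<in> G" and G: "G \<in> \<Gamma> ` {..<n}"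
  shows "v \<in> coord_space G"
proof -
  have vc: "v \<in> carrier_vec n" and Tv: "T v = \<alpha> \<cdot>\<^sub>v v"
    using v by (auto simp: is_eigenvector_def)
  have "\<Gamma> i = G" if i: "i < n" and nz: "ev i v \<noteq> 0" for i
  proof -
    let ?c = "ev i v"
    have "\<alpha> * ?c = \<sigma> ?c * a i + \<delta> ?c"
      using ev_T[OF vc i] ev_smult[OF vc, of i \<alpha>] Tv by simp
    then have "\<alpha> = \<sigma> ?c * a i * inverse ?c + \<delta> ?c * inverse ?c"
      using nz by (simp add: field_simps)
    then have "\<alpha> \<in> \<Gamma> i"
      unfolding conj_class_def using nz by blast
    moreover obtain k where "G = \<Gamma> k"
      using G by blast
    \<comment> \<open>Two classes sharing the element \<open>\<alpha>\<close> both equal the class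
      of \<open>\<alpha>\<close>.\<close>
    ultimately show "\<Gamma> i = G"
      using \<alpha> conj_class_eq[of \<alpha> "a i"] conj_class_eq[of \<alpha> "a k"] by simp
  qed
  then show ?thesis
    using vc by (auto simp: coord_space_def)
qed

text \<open>In evaluation coordinates this is the \<open>k\<close>-th standard basis vector:
  \<open>T\<close> sends its coordinate 1 to \<sigma>(1) \<open>a k\<close> + \<delta>(1) =
  \<open>a k\<close> and keeps the zeros.\<close>

lemma eigenvector_interp:
  assumes "k < n"
  shows "is_eigenvector n T (a k) (interp (\<lambda>i. if i = k then 1 else 0))" (is "is_eigenvector _ _ _ ?v")
proof -
  have "ev k ?v \<noteq> ev k (0\<^sub>v n)"
    using assms by simp
  then have "?v \<noteq> 0\<^sub>v n" by metis
  moreover have "T ?v = a k \<cdot>\<^sub>v ?v"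
    by (rule ev_inject) (auto simp: ev_T ev_smult)
  ultimately show ?thesis
    by (simp add: is_eigenvector_def)
qed

lemma eigen_span_eq:
  assumes G: "G \<in> \<Gamma> ` {..<n}"
  shows "eigen_span n T G = coord_space G"
proof -
  define S where "S = {v. \<exists>\<alpha>\<in>G. is_eigenvector n T \<alpha> v}"
  have S: "S \<subseteq> carrier_vec n"
    by (auto simp: S_def is_eigenvector_def)
  have sub: "submodule class_ring (span S) V"
    using S by (rule span_is_submodule)
  have "span S \<subseteq> coord_space G"
    by (rule span_is_subset[OF _ submodule_coord_space])
       (use G in \<open>auto simp: S_def intro: eigenvector_in_coord_space\<close>)
  moreover have "v \<in> span S" if v: "v \<in> coord_space G" for v
  proof -
    \<comment> \<open>The coordinates of \<open>v\<close> are restored one index at a time, each by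
      a multiple of the basis eigenvector for that index. With all indices of the class restored the
      vector is \<open>v\<close>, whose other coordinates vanish.\<close>
    have "interp (\<lambda>i. if i \<in> I then ev i v else 0) \<in> span S" if "I \<subseteq> {i. i < n \<and> \<Gamma> i = G}" for I
      using finite_subset[OF that] that
    proof (induction I rule: infinite_finite_induct)
      case empty
      have "interp (\<lambda>i. 0) = 0\<^sub>v n"
        by (rule ev_inject) auto
      then show ?case
        using submodule.zero_closed[OF sub] by (simp add: module_vec_simps)
    next
      case (insert k I)
      let ?e = "interp (\<lambda>i. if i = k then 1 else 0)"
      let ?w = "interp (\<lambda>i. if i \<in> I then ev i v else 0)"
      have "a k \<in> G" "k < n"
        using insert.prems conj_class_refl[of "a k"] by auto
      then have "?e \<in> span S"
        using eigenvector_interp in_own_span[OF S] unfolding S_def by blast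
      moreover have "?w \<in> span S"
        using insert by auto
      ultimately have "ev k v \<cdot>\<^sub>v ?e + ?w \<in> span S"
        using submodule.m_closed[OF sub] submodule.smult_closed[OF sub]
        by (simp add: module_vec_simps class_ring_simps)
      moreover have "interp (\<lambda>i. if i \<in> insert k I then ev i v else 0) = ev k v \<cdot>\<^sub>v ?e + ?w"
        by (rule ev_inject) (use insert in \<open>auto simp: ev_add ev_smult\<close>)
      ultimately show ?case by simp
    qed simp
    from this[OF subset_refl]
    have "interp (\<lambda>i. if i < n \<and> \<Gamma> i = G then ev i v else 0) \<in> span S" by simp
    also have "interp (\<lambda>i. if i < n \<and> \<Gamma> i = G then ev i v else 0) = v"
      by (rule ev_inject) (use v in \<open>auto simp: coord_space_def\<close>)
    finally show ?thesis .
  qed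
  ultimately show ?thesis
    unfolding eigen_span_def S_def[symmetric] by blast
qed

text \<open>\<open>T\<close> acts on each coordinate separately and fixes 0, as \<sigma>(0) =
  \<delta>(0) = 0.\<close>

lemma T_coord_space: "v \<in> coord_space G \<Longrightarrow> T v \<in> coord_space G"
  by (auto simp: coord_space_def ev_T)

lemma left_submodule_coord_space: "left_submodule n T (coord_space G)"
proof -
  have "ore_action n T g v \<in> coord_space G" if v: "v \<in> coord_space G" for g v
  proof -
    have "(T ^^ i) v \<in> coord_space G" for i
      by (induction i) (auto simp: v T_coord_space)
    then have Ti: "(T ^^ i) v \<in> carrier_vec n" "\<And>k. k < n \<Longrightarrow> \<Gamma> k \<noteq> G \<Longrightarrow> ev k ((T ^^ i) v) = 0" for i
      by (auto simp: coord_space_def)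
    have "(\<lambda>i. coeff g i \<cdot>\<^sub>v (T ^^ i) v) \<in> {..degree g} \<rightarrow> carrier_vec n"
      using Ti by auto
    from finsum_vec_closed[OF this] ev_finsum[OF finite_atMost this] Ti show ?thesis
      unfolding ore_action_def coord_space_def by (auto simp: ev_smult)
  qed
  then show ?thesis
    unfolding left_submodule_def by (auto simp: coord_space_def ev_add)
qed

section \<open>Projections onto the classes and the direct sum\<close>

definition coord_proj :: "'a set \<Rightarrow> 'a vec \<Rightarrow> 'a vec" where
  "coord_proj G v = interp (\<lambda>i. if \<Gamma> i = G then ev i v else 0)"

lemma coord_proj_in: "coord_proj G v \<in> coord_space G"
  by (auto simp: coord_proj_def coord_space_def)

lemma coord_proj_carrier [simp]: "coord_proj G v \<in> carrier_vec n"
  by (simp add: coord_proj_def)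

lemma ev_coord_proj [simp]: "i < n \<Longrightarrow> ev i (coord_proj G v) = (if \<Gamma> i = G then ev i v else 0)"
  by (simp add: coord_proj_def)

lemma coord_proj_ident: "v \<in> coord_space G \<Longrightarrow> coord_proj G v = v"
  by (rule ev_inject) (auto simp: coord_space_def)

lemma image_coord_proj: "coord_proj G ` carrier_vec n = coord_space G"
proof
  show "coord_space G \<subseteq> coord_proj G ` carrier_vec n"
  proof
    fix v assume "v \<in> coord_space G"
    then have "v = coord_proj G v" "v \<in> carrier_vec n"
      by (auto simp: coord_proj_ident coord_space_def)
    then show "v \<in> coord_proj G ` carrier_vec n" by blast
  qed
qed (auto simp: coord_proj_in)

lemma linear_map_coord_proj: "linear_map class_ring V V (coord_proj G)"
proof -
  have "coord_proj G (v + w) = coord_proj G v + coord_proj G w"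
    if "v \<in> carrier_vec n" "w \<in> carrier_vec n" for v w
    using that by (intro ev_inject) (auto simp: ev_add)
  moreover have "coord_proj G (c \<cdot>\<^sub>v v) = c \<cdot>\<^sub>v coord_proj G v" if "v \<in> carrier_vec n" for c v
    using that by (intro ev_inject) (auto simp: ev_smult)
  ultimately have "coord_proj G \<in> LinearCombinations.module_hom class_ring V V"
    by (auto simp: LinearCombinations.module_hom_def module_vec_simps)
  then show ?thesis
    by (intro linear_map.intro mod_hom.intro mod_hom_axioms.intro vec_vs vec_module)
qed

text \<open>Every index belongs to exactly one class, so every other summand has coordinate 0 at
  \<open>i\<close>.\<close>

lemma ev_finsum_classes:
  assumes w: "\<And>G. G \<in> \<Gamma> ` {..<n} \<Longrightarrow> w G \<in> coord_space G" and i: "i < n"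
  shows "ev i (finsum_vec TYPE('a) n w (\<Gamma> ` {..<n})) = ev i (w (\<Gamma> i))"
proof -
  have "w \<in> \<Gamma> ` {..<n} \<rightarrow> carrier_vec n"
    using w by (auto simp: coord_space_def)
  then have "ev i (finsum_vec TYPE('a) n w (\<Gamma> ` {..<n})) = (\<Sum>G\<in>\<Gamma> ` {..<n}. ev i (w G))"
    by (intro ev_finsum) auto
  also have "\<dots> = (\<Sum>G\<in>\<Gamma> ` {..<n}. if G = \<Gamma> i then ev i (w (\<Gamma> i)) else 0)"
    using w i by (intro sum.cong) (auto simp: coord_space_def)
  also have "\<dots> = ev i (w (\<Gamma> i))"
    using i by simp
  finally show ?thesis .
qed

lemma finsum_classes_closed:
  assumes "\<And>G. G \<in> \<Gamma> ` {..<n} \<Longrightarrow> w G \<in> coord_space G"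
  shows "finsum_vec TYPE('a) n w (\<Gamma> ` {..<n}) \<in> carrier_vec n"
  using assms by (intro finsum_vec_closed) (auto simp: coord_space_def)

lemma finsum_coord_proj:
  assumes "v \<in> carrier_vec n"
  shows "finsum_vec TYPE('a) n (\<lambda>G. coord_proj G v) (\<Gamma> ` {..<n}) = v"
proof (rule ev_inject)
  show "finsum_vec TYPE('a) n (\<lambda>G. coord_proj G v) (\<Gamma> ` {..<n}) \<in> carrier_vec n"
    by (rule finsum_classes_closed) (rule coord_proj_in)
  show "ev i (finsum_vec TYPE('a) n (\<lambda>G. coord_proj G v) (\<Gamma> ` {..<n})) = ev i v" if "i < n" for i
    using that by (subst ev_finsum_classes) (simp_all add: coord_proj_in)
qed (rule assms)

text \<open>Gives uniqueness of the decomposition: each component is recovered from the sum by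
  projecting.\<close>

lemma coord_proj_unique:
  assumes w: "\<And>G. G \<in> \<Gamma> ` {..<n} \<Longrightarrow> w G \<in> coord_space G"
    and G: "G \<in> \<Gamma> ` {..<n}"
  shows "w G = coord_proj G (finsum_vec TYPE('a) n w (\<Gamma> ` {..<n}))"
proof (rule ev_inject)
  show "w G \<in> carrier_vec n"
    using w[OF G] by (simp add: coord_space_def)
  show "ev i (w G) = ev i (coord_proj G (finsum_vec TYPE('a) n w (\<Gamma> ` {..<n})))" if "i < n" for i
    using w[OF G] that ev_finsum_classes[of w i, OF w that]
    by (auto simp: coord_space_def)
qed simp

lemma internal_direct_sum_eigen_span: "internal_direct_sum n (\<Gamma> ` {..<n}) (eigen_span n T)"
proof -
  have "\<exists>!w. w \<in> Pi\<^sub>E (\<Gamma> ` {..<n}) coord_space \<and> finsum_vec TYPE('a) n w (\<Gamma> ` {..<n}) = v"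
    if v: "v \<in> carrier_vec n" for v
  proof (rule ex1I)
    \<comment> \<open>The abstraction is restricted because members of \<open>Pi\<^sub>E\<close>
      must be \<open>undefined\<close> off the index set; otherwise uniqueness would fail.\<close>
    let ?w = "\<lambda>G\<in>\<Gamma> ` {..<n}. coord_proj G v"
    have w: "?w G \<in> coord_space G" if "G \<in> \<Gamma> ` {..<n}" for G
      using that by (simp add: coord_proj_in)
    have "finsum_vec TYPE('a) n ?w (\<Gamma> ` {..<n}) = v"
      using v by (intro ev_inject finsum_classes_closed w) (simp_all add: ev_finsum_classes[OF w] del: finsum_vec)
    then show "?w \<in> Pi\<^sub>E (\<Gamma> ` {..<n}) coord_space \<and> finsum_vec TYPE('a) n ?w (\<Gamma> ` {..<n}) = v"
      using coord_proj_in by auto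
    fix w assume "w \<in> Pi\<^sub>E (\<Gamma> ` {..<n}) coord_space \<and> finsum_vec TYPE('a) n w (\<Gamma> ` {..<n}) = v"
    then have wP: "w \<in> Pi\<^sub>E (\<Gamma> ` {..<n}) coord_space"
      and wv: "finsum_vec TYPE('a) n w (\<Gamma> ` {..<n}) = v" by auto
    have win: "w G \<in> coord_space G" if "G \<in> \<Gamma> ` {..<n}" for G
      using wP that by (rule PiE_mem)
    show "w = ?w"
      using coord_proj_unique[of w, OF win] wP unfolding wv
      by (intro PiE_ext[OF wP]) (auto simp: coord_proj_in)
  qed
  moreover have "Pi\<^sub>E (\<Gamma> ` {..<n}) (eigen_span n T) = Pi\<^sub>E (\<Gamma> ` {..<n}) coord_space"
    by (rule PiE_cong) (rule eigen_span_eq)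
  moreover have "subspace class_ring (eigen_span n T G) V" if "G \<in> \<Gamma> ` {..<n}" for G
    unfolding eigen_span_eq[OF that] subspace_def by (intro conjI vec_vs submodule_coord_space)
  ultimately show ?thesis
    unfolding internal_direct_sum_def by (simp del: finsum_vec)
qed

end

text \<open>The sum and the projections are indexed by the set of distinct classes, since several
  points may be conjugate. Every such class has an eigenvector, so repeating its summand would
  destroy directness.\<close>

theorem theorem7:
  fixes \<sigma> \<delta> :: "'a::{field,finite} \<Rightarrow> 'a"
    and f :: "'a poly" and n :: nat and a :: "nat \<Rightarrow> 'a"
  assumes "ore_data \<sigma> \<delta>"
    and "W_polynomial \<sigma> \<delta> f" and "degree f = n"
    and "inj_on a {..<n}" and "P_independent \<sigma> \<delta> (a ` {..<n})"
    and "is_min_poly \<sigma> \<delta> (a ` {..<n}) f"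
    and "[:0, 1:] \<in> idealizer \<sigma> \<delta> f"
  shows "let T = pseudo_lin \<sigma> \<delta> (companion n f);
             V = eigen_span n T;
             \<Gamma> = (\<lambda>i. conj_class \<sigma> \<delta> (a i));
             \<G> = \<Gamma> ` {..<n}
         in internal_direct_sum n \<G> V
          \<and> (\<forall>i<n. T ` V (\<Gamma> i) \<subseteq> V (\<Gamma> i) \<and> left_submodule n T (V (\<Gamma> i)))
          \<and> (\<exists>E :: 'a set \<Rightarrow> 'a vec \<Rightarrow> 'a vec.
               (\<forall>G\<in>\<G>. linear_map class_ring (module_vec TYPE('a) n) (module_vec TYPE('a) n) (E G))
             \<and> (\<forall>v\<in>carrier_vec n. finsum_vec TYPE('a) n (\<lambda>G. E G v) \<G> = v)
             \<and> (\<forall>G\<in>\<G>. \<forall>H\<in>\<G>. G \<noteq> H \<longrightarrow> (\<forall>v\<in>carrier_vec n. E G (E H v) = 0\<^sub>v n))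
             \<and> (\<forall>i<n. E (\<Gamma> i) ` carrier_vec n = V (\<Gamma> i)))"
proof -
  interpret ore_min_poly \<sigma> \<delta> f n a
    using assms by (intro ore_min_poly.intro ore_min_poly_axioms.intro)
  have span: "eigen_span n T (\<Gamma> i) = coord_space (\<Gamma> i)" if "i < n" for i
    using that by (intro eigen_span_eq) simp
  \<comment> \<open>No index has both classes, so each coordinate is killed by one of the two
    projections.\<close>
  have "coord_proj G (coord_proj H v) = 0\<^sub>v n" if "G \<noteq> H" for G H v
    using that by (intro ev_eq_0_imp) auto
  then show ?thesis
    unfolding Let_def
    by (intro conjI exI[of _ coord_proj])
       (auto simp del: finsum_vec simp: span T_coord_space left_submodule_coord_space linear_map_coord_proj
          finsum_coord_proj image_coord_proj internal_direct_sum_eigen_span)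
qed

end
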